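(* (Multiple bus splits.) Let a power grid containing busbar couplers or switches $e_1,\dots,e_M$ be given, and assume that the grid with all these couplers open is connected. Let $\boldsymbol B_o$ be the grounded Laplacian of the grid with all couplers open, let $\boldsymbol U=(\boldsymbol\nu_{e_1}\ \cdots\ \boldsymbol\nu_{e_M})$, and let $$\boldsymbol B_c^{-1}=\lim_{b_1,\dots,b_M\to\infty}\Big(\boldsymbol B_o+\sum_{i=1}^M b_i\boldsymbol\nu_{e_i}\boldsymbol\nu_{e_i}^\top\Big)^{-1}$$ be the inverse grounded Laplacian of the grid with all couplers ideally closed (but not merged). Then $$\boldsymbol B_o^{-1}=\boldsymbol B_c^{-1}+\big(\mathbb 1-\boldsymbol B_c^{-1}\boldsymbol B_o\big)\boldsymbol U\Big[\boldsymbol U^\top\big(\boldsymbol B_o-\boldsymbol B_o\boldsymbol B_c^{-1}\boldsymbol B_o\big)\boldsymbol U\Big]^{-1}\boldsymbol U^\top\big(\mathbb 1-\boldsymbol B_o\boldsymbol B_c^{-1}\big).$$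
   Context: A grid is a finite graph with buses (nodes) $1,\dots,N_n$ and branches (edges) $1,\dots,N_e$, each branch joining two distinct buses (parallel branches allowed) and carrying a fixed orientation. One bus is chosen as slack bus. The grounded node-edge incidence matrix $\boldsymbol E$ has size $(N_n-1)\times N_e$: $E_{n,e}=+1$ if branch $e$ starts at bus $n$, $-1$ if it ends at $n$, $0$ otherwise, with the row of the slack bus removed. $\boldsymbol u_e$ is the $e$-th standard basis vector of $\mathbb R^{N_e}$ and $\boldsymbol\nu_e=\boldsymbol E\boldsymbol u_e$. $\mathbb 1$ is the identity matrix. The couplers $e_1,\dots,e_M$ are distinct branches included as columns of $\boldsymbol E$; coupler $e_i$ has susceptance $b_i=0$ when open and $b_i\to\infty$ when closed. All other branches $e$ have susceptance $b_e>0$. Let $\mathfrak B_o$ be the diagonal matrix with entries $b_e$ for $e\notin\{e_1,\dots,e_M\}$ and $0$ for the couplers. The grounded Laplacian of the open grid is $\boldsymbol B_o=\boldsymbol E\,\mathfrak B_o\boldsymbol E^\top$; connectedness of the open grid means that the graph formed by the non-coupler branches is connected, so that $\boldsymbol B_o$ is invertible. The symbol $\boldsymbol B_c^{-1}$ denotes the stated entrywise limit, all $b_i$ tending to $+\infty$ jointly; it is notation and not the inverse of a matrix.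
   Formalization: The formula is proved whenever the bracketed matrix is invertible, which is shown to hold exactly when U has full column rank M; if couplers form a cycle (e.g. two parallel couplers), the bracket is singular and the formula as stated is undefined. *)

theory Defs
  imports "HOL-Analysis.Analysis" "Graph_Theory.Digraph_Component"
begin

text \<open>
  A grid is a loop-free directed multigraph \<open>G\<close> whose buses and branches are all the elements of
  two finite types; the direction of an arc is the fixed orientation of the branch.
  The rows of the grounded matrices are indexed by a type \<open>'r\<close>, and \<open>bus\<close> enumerates
  the buses other than the slack bus.
\<close>

definition grid_with_slack ::
  "('v::finite, 'e::finite) pre_digraph \<Rightarrow> 'v \<Rightarrow> ('r::finite \<Rightarrow> 'v) \<Rightarrow> bool" where
  "grid_with_slack G slack bus \<longleftrightarrow>
     loopfree_digraph G \<and> verts G = UNIV \<and> arcs G = UNIV \<and> bij_betw bus UNIV (UNIV - {slack})"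

definition incidence ::
  "('v::finite, 'e::finite) pre_digraph \<Rightarrow> ('r::finite \<Rightarrow> 'v) \<Rightarrow> real^'e^'r" where
  "incidence G bus =
     (\<chi> r e. if tail G e = bus r then 1 else if head G e = bus r then -1 else 0)"

definition branch_vec ::
  "('v::finite, 'e::finite) pre_digraph \<Rightarrow> ('r::finite \<Rightarrow> 'v) \<Rightarrow> 'e \<Rightarrow> real^'r" where
  "branch_vec G bus e = incidence G bus *v axis e 1"

text \<open>The couplers are given by an injective map \<open>c\<close> from an index type to the branches.\<close>

definition open_grid ::
  "('v, 'e) pre_digraph \<Rightarrow> ('m \<Rightarrow> 'e) \<Rightarrow> ('v, 'e) pre_digraph" where
  "open_grid G c = G\<lparr>arcs := arcs G - range c\<rparr>"

definition open_susceptance :: "('m \<Rightarrow> 'e::finite) \<Rightarrow> ('e \<Rightarrow> real) \<Rightarrow> real^'e^'e" where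
  "open_susceptance c b = (\<chi> e f. if e = f \<and> e \<notin> range c then b e else 0)"

definition open_laplacian ::
  "('v::finite, 'e::finite) pre_digraph \<Rightarrow> ('r::finite \<Rightarrow> 'v) \<Rightarrow> ('m::finite \<Rightarrow> 'e) \<Rightarrow>
   ('e \<Rightarrow> real) \<Rightarrow> real^'r^'r" where
  "open_laplacian G bus c b =
     incidence G bus ** open_susceptance c b ** transpose (incidence G bus)"

definition coupler_matrix ::
  "('v::finite, 'e::finite) pre_digraph \<Rightarrow> ('r::finite \<Rightarrow> 'v) \<Rightarrow> ('m::finite \<Rightarrow> 'e) \<Rightarrow>
   real^'m^'r" where
  "coupler_matrix G bus c = (\<chi> r i. branch_vec G bus (c i) $ r)"

definition outer :: "real^'r \<Rightarrow> real^'r^'r" where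
  "outer v = (columnvector v :: real^1^'r) ** rowvector v"

definition coupled_laplacian ::
  "('v::finite, 'e::finite) pre_digraph \<Rightarrow> ('r::finite \<Rightarrow> 'v) \<Rightarrow> ('m::finite \<Rightarrow> 'e) \<Rightarrow>
   ('e \<Rightarrow> real) \<Rightarrow> ('m \<Rightarrow> real) \<Rightarrow> real^'r^'r" where
  "coupled_laplacian G bus c b \<beta> =
     open_laplacian G bus c b + (\<Sum>i\<in>UNIV. \<beta> i *\<^sub>R outer (branch_vec G bus (c i)))"

text \<open>All coupler susceptances tend to infinity jointly, with no relation between their rates.\<close>

definition all_at_top :: "('m \<Rightarrow> real) filter" where
  "all_at_top = (INF i. filtercomap (\<lambda>\<beta>. \<beta> i) at_top)"

lemma eventually_all_at_top:
  "eventually P (all_at_top :: ('m::finite \<Rightarrow> real) filter) \<longleftrightarrow>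
     (\<exists>K. \<forall>\<beta>. (\<forall>i. K \<le> \<beta> i) \<longrightarrow> P \<beta>)"
proof
  assume "eventually P (all_at_top :: ('m \<Rightarrow> real) filter)"
  then obtain Q where Q: "\<forall>i. eventually (Q i) (filtercomap (\<lambda>\<beta>::'m \<Rightarrow> real. \<beta> i) at_top)"
    and P: "\<forall>\<beta>. (\<forall>i. Q i \<beta>) \<longrightarrow> P \<beta>"
    unfolding all_at_top_def eventually_INF_finite[OF finite] by auto
  have "\<exists>k. \<forall>\<beta>. k \<le> \<beta> i \<longrightarrow> Q i \<beta>" for i
  proof -
    obtain R where R: "eventually R (at_top :: real filter)" "\<forall>\<beta>. R (\<beta> i) \<longrightarrow> Q i \<beta>"
      using Q[rule_format, of i] unfolding eventually_filtercomap by blast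
    then show ?thesis unfolding eventually_at_top_linorder by blast
  qed
  then have "\<exists>k. \<forall>i. \<forall>\<beta>. k i \<le> \<beta> i \<longrightarrow> Q i \<beta>" by (intro choice allI)
  then obtain k where k: "\<forall>i. \<forall>\<beta>. k i \<le> \<beta> i \<longrightarrow> Q i \<beta>" by (elim exE)
  have "P \<beta>" if le: "\<forall>i. Max (range k) \<le> \<beta> i" for \<beta>
  proof -
    have "k i \<le> \<beta> i" for i
      by (rule order_trans[OF _ le[rule_format]]) simp
    then show ?thesis using P k by simp
  qed
  then show "\<exists>K. \<forall>\<beta>. (\<forall>i. K \<le> \<beta> i) \<longrightarrow> P \<beta>" by blast
next
  assume "\<exists>K. \<forall>\<beta>. (\<forall>i. K \<le> \<beta> i) \<longrightarrow> P \<beta>"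
  then obtain K where K: "\<And>\<beta>. (\<forall>i. K \<le> \<beta> i) \<Longrightarrow> P \<beta>" by blast
  have "eventually (\<lambda>\<beta>. K \<le> \<beta> i) (all_at_top :: ('m \<Rightarrow> real) filter)" for i
  proof -
    have "eventually (\<lambda>\<beta>. K \<le> \<beta> i) (filtercomap (\<lambda>\<beta>::'m \<Rightarrow> real. \<beta> i) at_top)"
      by (rule eventually_filtercomapI) (rule eventually_ge_at_top)
    moreover have "all_at_top \<le> filtercomap (\<lambda>\<beta>::'m \<Rightarrow> real. \<beta> i) at_top"
      unfolding all_at_top_def by (rule INF_lower) simp
    ultimately show ?thesis by (rule filter_leD[rotated])
  qed
  then have "eventually (\<lambda>\<beta>. \<forall>i. K \<le> \<beta> i) (all_at_top :: ('m \<Rightarrow> real) filter)"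
    by (rule eventually_all_finite)
  then show "eventually P (all_at_top :: ('m \<Rightarrow> real) filter)"
    by (rule eventually_mono) (rule K)
qed

lemma all_at_top_neq_bot: "(all_at_top :: ('m::finite \<Rightarrow> real) filter) \<noteq> bot"
proof
  assume "(all_at_top :: ('m \<Rightarrow> real) filter) = bot"
  then have "eventually (\<lambda>_. False) (all_at_top :: ('m \<Rightarrow> real) filter)" by simp
  then obtain K :: real where "\<forall>\<beta>::'m \<Rightarrow> real. (\<forall>i. K \<le> \<beta> i) \<longrightarrow> False" unfolding eventually_all_at_top by blast
  from this[rule_format, of "\<lambda>_. K"] show False by simp
qed

text \<open>The matrix written \<open>B_c^{-1}\<close>: a limit of inverses, itself not the inverse of a matrix.\<close>

definition closed_inverse ::
  "('v::finite, 'e::finite) pre_digraph \<Rightarrow> ('r::finite \<Rightarrow> 'v) \<Rightarrow> ('m::finite \<Rightarrow> 'e) \<Rightarrow>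
   ('e \<Rightarrow> real) \<Rightarrow> real^'r^'r" where
  "closed_inverse G bus c b =
     Lim all_at_top (\<lambda>\<beta>. matrix_inv (coupled_laplacian G bus c b \<beta>))"

end

theory Submission
  imports Defs
begin

text \<open>
  Write \<open>A\<close> for \<open>B_o\<close>, which is positive definite because the open grid is connected.  The limit
  matrix \<open>X\<close> is the inverse of \<open>A\<close> compressed to \<open>ker U\<^sup>T\<close>: the unique \<open>X\<close> with \<open>U\<^sup>T X = 0\<close> and
  \<open>A X + U S = 1\<close> for some \<open>S\<close>.  An energy estimate shows that the inverses converge to it at
  arbitrary relative rates and even if \<open>U\<close> is rank deficient.  Since \<open>X A X = X\<close>, we get
  \<open>K = ((1 - X A) U)\<^sup>T A (1 - X A) U\<close>, whose kernel is that of \<open>U\<close>.  The formula follows from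
  \<open>K = (U\<^sup>T U) (S A U)\<close>: if \<open>K\<close> is invertible, then \<open>S A U K\<^sup>-\<^sup>1 U\<^sup>T U = 1\<close>.
\<close>

section \<open>Matrix algebra and positive definite matrices\<close>

lemma matrix_diff_ldistrib: "A ** (B - C) = A ** B - A ** (C :: real^'n^'m)"
  by (simp add: matrix_eq matrix_vector_mul_assoc[symmetric] algebra_simps)

lemma matrix_diff_rdistrib: "(A - B) ** C = A ** C - B ** (C :: real^'n^'m)"
  by (simp add: matrix_eq matrix_vector_mul_assoc[symmetric] algebra_simps)

lemma transpose_diff: "transpose (A - B) = transpose A - transpose (B :: real^'n^'m)"
  by (simp add: transpose_def vec_eq_iff)

lemma matrix_inv_mult:
  fixes A :: "real^'n^'n"
  assumes "invertible A"
  shows "matrix_inv A ** A = mat 1" "A ** matrix_inv A = mat 1"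
  using someI_ex[OF assms[unfolded invertible_def]] unfolding matrix_inv_def by auto

lemma matrix_inv_eqI:
  fixes A :: "real^'n^'n"
  assumes "A ** B = mat 1"
  shows "matrix_inv A = B"
proof -
  have "invertible A" using assms invertible_right_inverse by blast
  then have "matrix_inv A ** (A ** B) = B"
    by (simp add: matrix_mul_assoc matrix_inv_mult)
  then show ?thesis by (simp add: assms)
qed

lemma invertible_if_posdef:
  fixes A :: "real^'n^'n"
  assumes "\<And>x. x \<noteq> 0 \<Longrightarrow> 0 < x \<bullet> (A *v x)"
  shows "invertible A"
  unfolding invertible_left_inverse matrix_left_invertible_ker
  using assms by (metis inner_zero_right less_irrefl)

text \<open>The constant is the minimum of the quadratic form on the compact unit sphere;
  homogeneity of degree two extends the bound to all vectors.\<close>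

lemma posdef_coercive:
  fixes A :: "real^'n^'n"
  assumes pos: "\<And>x. x \<noteq> 0 \<Longrightarrow> 0 < x \<bullet> (A *v x)"
  obtains \<alpha> where "0 < \<alpha>" "\<And>x. \<alpha> * (norm x)\<^sup>2 \<le> x \<bullet> (A *v x)"
proof -
  have cont: "continuous_on (sphere 0 1) (\<lambda>x. x \<bullet> (A *v x))"
    by (intro continuous_intros linear_continuous_on matrix_vector_mul_bounded_linear)
  have "sphere (0::real^'n) 1 \<noteq> {}" by simp
  then obtain w where w: "norm w = 1"
    "\<And>x. norm x = 1 \<Longrightarrow> w \<bullet> (A *v w) \<le> x \<bullet> (A *v x)"
    using continuous_attains_inf[OF compact_sphere _ cont] by auto
  have "(w \<bullet> (A *v w)) * (norm x)\<^sup>2 \<le> x \<bullet> (A *v x)" for x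
  proof (cases "x = 0")
    case False
    have "w \<bullet> (A *v w) \<le> (x /\<^sub>R norm x) \<bullet> (A *v (x /\<^sub>R norm x))"
      by (rule w(2)) (simp add: False)
    also have "\<dots> = x \<bullet> (A *v x) / (norm x)\<^sup>2"
      by (simp add: matrix_vector_mult_scaleR power2_eq_square divide_simps)
    finally show ?thesis using False by (simp add: field_simps)
  qed simp
  moreover have "0 < w \<bullet> (A *v w)" using pos[of w] w(1) by force
  ultimately show ?thesis using that by blast
qed

section \<open>Rank-one updates and the constrained inverse\<close>

lemma inner_matrix_mult:
  "x \<bullet> (U *v s) = (transpose U *v x) \<bullet> (s :: real^'m)" for x :: "real^'n"
  by (simp add: dot_lmul_matrix)

lemma transpose_mult_nth: "(transpose U *v x) $ i = column i U \<bullet> (x :: real^'n)"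
  by (simp add: transpose_def column_def matrix_vector_mult_def inner_vec_def vec_eq_iff
      del: transpose_matrix_vector)

lemma outer_mult: "outer v *v x = (v \<bullet> x) *\<^sub>R v"
  by (simp add: outer_def columnvector_def rowvector_def matrix_matrix_mult_def
      matrix_vector_mult_def inner_vec_def vec_eq_iff sum_distrib_left sum_distrib_right ac_simps)

lemma coupled_mult:
  "(A + (\<Sum>i\<in>UNIV. \<beta> i *\<^sub>R outer (u i))) *v x
     = A *v x + (\<Sum>i\<in>(UNIV::'m::finite set). (\<beta> i * (u i \<bullet> x)) *\<^sub>R u i)"
proof -
  have "(\<Sum>i\<in>I. \<beta> i *\<^sub>R outer (u i)) *v x = (\<Sum>i\<in>I. (\<beta> i * (u i \<bullet> x)) *\<^sub>R u i)"
    if "finite I" for I :: "'m set"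
    using that
    by induction (simp_all add: matrix_vector_mult_add_rdistrib outer_mult flip: scaleR_matrix_vector_assoc)
  then show ?thesis by (simp add: matrix_vector_mult_add_rdistrib)
qed

lemma inner_coupled:
  "x \<bullet> ((A + (\<Sum>i\<in>UNIV. \<beta> i *\<^sub>R outer (u i))) *v x)
     = x \<bullet> (A *v x) + (\<Sum>i\<in>(UNIV::'m::finite set). \<beta> i * (u i \<bullet> x)\<^sup>2)"
  by (simp add: coupled_mult inner_add_right inner_sum_right power2_eq_square
      inner_commute ac_simps)

lemma invertible_coupled:
  assumes "\<And>x. x \<noteq> 0 \<Longrightarrow> 0 < x \<bullet> (A *v x)" "\<And>i. 0 \<le> \<beta> i"
  shows "invertible (A + (\<Sum>i\<in>(UNIV::'m::finite set). \<beta> i *\<^sub>R outer (u i)))"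
  using assms
  by (intro invertible_if_posdef) (simp add: inner_coupled add_pos_nonneg sum_nonneg)

text \<open>This is a saddle-point system with multipliers \<open>S\<close>. It is solvable because
  only zero is orthogonal to the set \<open>T\<close> of attainable right-hand sides; linearly
  dependent columns of \<open>U\<close> are allowed.\<close>

lemma constrained_inverse_exists:
  fixes A :: "real^'n^'n" and U :: "real^'m^'n"
  assumes pos: "\<And>x. x \<noteq> 0 \<Longrightarrow> 0 < x \<bullet> (A *v x)"
  obtains X S where "transpose U ** X = 0" "A ** X + U ** S = mat 1"
proof -
  define T where "T = {A *v x + U *v s | x s. transpose U *v x = 0}"
  have "subspace T"
    unfolding T_def subspace_def
  proof (safe, goal_cases)
    case 1 show ?case by (rule exI[of _ 0], rule exI[of _ 0]) simp
  next
    case (2 _ _ x x' s s') then show ?case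
      by (intro exI[of _ "x + x'"] exI[of _ "s + s'"])
        (simp add: matrix_vector_right_distrib vector_matrix_mult_add_rdistrib)
  next
    case (3 c _ x s) then show ?case
      by (intro exI[of _ "c *\<^sub>R x"] exI[of _ "c *\<^sub>R s"])
        (simp add: matrix_vector_mult_scaleR scaleR_add_right del: transpose_matrix_vector)
  qed
  have "y \<in> T" for y
  proof -
    obtain t z where t: "t \<in> span T" and z: "\<And>w. w \<in> span T \<Longrightarrow> orthogonal z w" and y: "y = t + z"
      using orthogonal_subspace_decomp_exists by blast
    have zT: "z \<bullet> w = 0" if "w \<in> T" for w
      using z span_base that by (auto simp: orthogonal_def)
    \<comment> \<open>Taking \<open>x = 0\<close> puts the range of \<open>U\<close> into
      \<open>T\<close>, so \<open>z\<close> satisfies the constraint and is itself admissible as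
      \<open>x\<close>. Then \<open>A *v z\<close> is orthogonal to \<open>z\<close>, which
      positivity permits only for \<open>z = 0\<close>.\<close>
    have "U *v s \<in> T" for s
      unfolding T_def by (auto intro!: exI[of _ 0] exI[of _ s])
    then have "(transpose U *v z) \<bullet> (transpose U *v z) = 0"
      using zT by (simp only: inner_matrix_mult[symmetric])
    then have Uz: "transpose U *v z = 0" by simp
    then have "A *v z \<in> T"
      unfolding T_def by (auto intro!: exI[of _ 0] exI[of _ z])
    then have "z = 0" using zT pos by force
    then show ?thesis using t y \<open>subspace T\<close> by (simp add: span_eq_iff[THEN iffD2])
  qed
  \<comment> \<open>The solutions for the standard basis vectors become the columns of
    \<open>X\<close> and \<open>S\<close>.\<close>
  then have "\<forall>j. \<exists>x s. transpose U *v x = 0 \<and> A *v x + U *v s = axis j 1"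
    unfolding T_def mem_Collect_eq by metis
  then obtain x s where xs: "\<And>j. transpose U *v x j = 0" "\<And>j. A *v x j + U *v s j = axis j 1"
    by metis
  have "transpose U ** (\<chi> i j. x j $ i) = 0"
    using xs(1) by (simp add: vec_eq_iff matrix_matrix_mult_def matrix_vector_mult_def
        del: transpose_matrix_vector)
  moreover have "A ** (\<chi> i j. x j $ i) + U ** (\<chi> i j. s j $ i) = mat 1"
    using xs(2) by (simp add: vec_eq_iff matrix_matrix_mult_def matrix_vector_mult_def mat_def axis_def)
  ultimately show ?thesis using that by blast
qed

section \<open>Convergence of the inverses as the couplers close\<close>

lemma filterlim_all_at_top: "filterlim (\<lambda>\<beta>. \<beta> i) at_top all_at_top"
  unfolding filterlim_iff_le_filtercomap all_at_top_def by (rule INF_lower) simp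

text \<open>For \<open>d = L(\<beta>)\<^sup>-\<^sup>1 y - X y\<close> one has \<open>A d + \<Sum>\<^sub>i \<beta>\<^sub>i (u\<^sub>i \<bullet> d) u\<^sub>i = \<Sum>\<^sub>i s\<^sub>i u\<^sub>i\<close> with \<open>s = S y\<close>; pair with \<open>d\<close> and
  complete the squares.\<close>

lemma coupled_energy_bound:
  fixes u :: "'m::finite \<Rightarrow> real^'n"
  assumes \<beta>: "\<And>i. 0 < \<beta> i"
    and eq: "(A + (\<Sum>i\<in>UNIV. \<beta> i *\<^sub>R outer (u i))) *v d = (\<Sum>i\<in>UNIV. s i *\<^sub>R u i)"
  shows "d \<bullet> (A *v d) \<le> (\<Sum>i\<in>UNIV. (s i)\<^sup>2 / (4 * \<beta> i))"
proof -
  have square: "s i * (u i \<bullet> d) \<le> \<beta> i * (u i \<bullet> d)\<^sup>2 + (s i)\<^sup>2 / (4 * \<beta> i)" for i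
  proof -
    have "0 \<le> (2 * \<beta> i * (u i \<bullet> d) - s i)\<^sup>2 / (4 * \<beta> i)" using \<beta>[of i] by simp
    also have "\<dots> = \<beta> i * (u i \<bullet> d)\<^sup>2 + (s i)\<^sup>2 / (4 * \<beta> i) - s i * (u i \<bullet> d)"
      using \<beta>[of i] by (simp add: field_simps power2_eq_square)
    finally show ?thesis by simp
  qed
  have "d \<bullet> (A *v d) + (\<Sum>i\<in>UNIV. \<beta> i * (u i \<bullet> d)\<^sup>2) = (\<Sum>i\<in>UNIV. s i * (u i \<bullet> d))"
    unfolding inner_coupled[symmetric] eq by (simp add: inner_sum_right inner_commute)
  also have "\<dots> \<le> (\<Sum>i\<in>UNIV. \<beta> i * (u i \<bullet> d)\<^sup>2) + (\<Sum>i\<in>UNIV. (s i)\<^sup>2 / (4 * \<beta> i))"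
    unfolding sum.distrib[symmetric] by (intro sum_mono square)
  finally show ?thesis by simp
qed

text \<open>Coercivity turns the energy bound into a bound on the squared error by a sum of
  constants over the \<open>\<beta> i\<close>. Each summand vanishes separately, so the relative
  rates never enter.\<close>

lemma coupled_inverse_tendsto:
  fixes A X :: "real^'n^'n" and U :: "real^'m^'n"
  assumes pos: "\<And>x. x \<noteq> 0 \<Longrightarrow> 0 < x \<bullet> (A *v x)"
    and X: "transpose U ** X = 0" "A ** X + U ** S = mat 1"
  shows "((\<lambda>\<beta>. matrix_inv (A + (\<Sum>i\<in>UNIV. \<beta> i *\<^sub>R outer (column i U)))) \<longlongrightarrow> X) all_at_top"
    (is "((\<lambda>\<beta>. matrix_inv (?L \<beta>)) \<longlongrightarrow> X) _")
proof -
  obtain \<alpha> where \<alpha>: "0 < \<alpha>" "\<And>x. \<alpha> * (norm x)\<^sup>2 \<le> x \<bullet> (A *v x)"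
    using posdef_coercive[OF pos] by blast
  have "((\<lambda>\<beta>. matrix_inv (?L \<beta>) *v y) \<longlongrightarrow> X *v y) all_at_top" for y
  proof -
    define s where "s = S *v y"
    define d where "d \<beta> = matrix_inv (?L \<beta>) *v y - X *v y" for \<beta>
    define g where "g \<beta> = (\<Sum>i\<in>UNIV. (s $ i)\<^sup>2 / (4 * \<beta> i)) / \<alpha>" for \<beta>
    have UX: "column i U \<bullet> (X *v y) = 0" for i
    proof -
      have "transpose U *v (X *v y) = 0" by (simp only: matrix_vector_mul_assoc X(1)) simp
      then show ?thesis by (metis transpose_mult_nth zero_index)
    qed
    have y: "y = A *v (X *v y) + U *v s"
      unfolding s_def matrix_vector_mul_assoc
      by (simp only: matrix_vector_mult_add_rdistrib[symmetric] X(2)) simp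
    \<comment> \<open>The threshold 1 serves to make every \<open>\<beta> i\<close> positive; any
      positive threshold would do.\<close>
    have bound: "(norm (d \<beta>))\<^sup>2 \<le> g \<beta>" if \<beta>: "\<forall>i. 1 \<le> \<beta> i" for \<beta>
    proof -
      have \<beta>0: "0 < \<beta> i" for i using \<beta> by (meson less_le_trans zero_less_one)
      have "invertible (?L \<beta>)" by (rule invertible_coupled[OF pos less_imp_le[OF \<beta>0]])
      then have "?L \<beta> *v (matrix_inv (?L \<beta>) *v y) = y"
        by (simp add: matrix_vector_mul_assoc matrix_inv_mult)
      \<comment> \<open>The rank-one terms annihilate \<open>X *v y\<close>, so the residual does
        not depend on \<open>\<beta>\<close> and lies in the range of \<open>U\<close>.\<close>
      then have "?L \<beta> *v d \<beta> = y - A *v (X *v y)"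
        unfolding d_def matrix_vector_mult_diff_distrib by (simp add: coupled_mult UX)
      also have "\<dots> = (\<Sum>i\<in>UNIV. s $ i *\<^sub>R column i U)"
        by (subst y) (simp add: matrix_mult_sum scalar_mult_eq_scaleR)
      finally have "d \<beta> \<bullet> (A *v d \<beta>) \<le> (\<Sum>i\<in>UNIV. (s $ i)\<^sup>2 / (4 * \<beta> i))"
        by (rule coupled_energy_bound[OF \<beta>0])
      with \<alpha>(2)[of "d \<beta>"] show ?thesis
        using \<alpha>(1) by (simp add: g_def field_simps)
    qed
    have "filterlim (\<lambda>\<beta>. 4 * \<beta> i) at_top (all_at_top :: ('m \<Rightarrow> real) filter)" for i
      by (intro filterlim_tendsto_pos_mult_at_top[OF tendsto_const] filterlim_all_at_top) simp
    then have "((\<lambda>\<beta>. (s $ i)\<^sup>2 / (4 * \<beta> i)) \<longlongrightarrow> 0) all_at_top" for i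
      by (intro real_tendsto_divide_at_top[OF tendsto_const])
    then have "(g \<longlongrightarrow> (\<Sum>i\<in>(UNIV::'m set). 0) / \<alpha>) all_at_top"
      unfolding g_def using \<alpha>(1) by (intro tendsto_intros) auto
    then have g0: "(g \<longlongrightarrow> 0) all_at_top" by simp
    have ev: "\<forall>\<^sub>F \<beta> in all_at_top. (norm (d \<beta>))\<^sup>2 \<le> g \<beta>"
      unfolding eventually_all_at_top using bound by blast
    have "((\<lambda>\<beta>. (norm (d \<beta>))\<^sup>2) \<longlongrightarrow> 0) all_at_top"
      by (rule tendsto_sandwich[OF _ ev tendsto_const g0]) simp
    from tendsto_real_sqrt[OF this] have "(d \<longlongrightarrow> 0) all_at_top"
      by (simp add: tendsto_norm_zero_iff)
    then show ?thesis unfolding d_def by (simp add: LIM_zero_iff)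
  qed
  \<comment> \<open>Applied to standard basis vectors, pointwise convergence is convergence of the
    columns, hence of all entries.\<close>
  from tendsto_vec_nth[OF this[of "axis _ 1"]] show ?thesis
    by (intro vec_tendstoI) (simp add: matrix_vector_mult_basis column_def)
qed


section \<open>Algebra of the limit matrix and the splitting formula\<close>

lemma constrained_inverse_sym:
  fixes A X :: "real^'n^'n" and U :: "real^'m^'n"
  assumes sym: "transpose A = A"
    and X: "transpose U ** X = 0" "A ** X + U ** S = mat 1"
  shows "transpose X = X" "X ** A ** X = X"
proof -
  have "transpose X ** U = transpose (transpose U ** X)" by (simp add: matrix_transpose_mul)
  then have XU: "transpose X ** U = 0" by (simp only: X(1)) (simp add: transpose_def vec_eq_iff)
  \<comment> \<open>Multiplying the defining equation by \<open>transpose X\<close> from the left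
    removes the multiplier term. What remains equates \<open>transpose X\<close> with a symmetric
    matrix.\<close>
  have "transpose X ** A ** X + transpose X ** U ** S = transpose X"
    by (simp add: matrix_mul_assoc[symmetric] matrix_add_ldistrib[symmetric] X(2))
  then have eq: "transpose X ** A ** X = transpose X" by (simp add: XU)
  have "X = transpose (transpose X ** A ** X)" by (simp add: eq)
  also have "\<dots> = transpose X ** A ** X" by (simp add: matrix_transpose_mul sym matrix_mul_assoc)
  finally show "transpose X = X" by (simp add: eq)
  then show "X ** A ** X = X" using eq by simp
qed

text \<open>Both matrices have the same kernel; its triviality means invertibility for the square
  \<open>?K\<close> and full column rank for \<open>U\<close>.\<close>

lemma invertible_coupler_matrix_iff:
  fixes A X :: "real^'n^'n" and U :: "real^'m^'n"
  assumes pos: "\<And>x. x \<noteq> 0 \<Longrightarrow> 0 < x \<bullet> (A *v x)" and sym: "transpose A = A"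
    and X: "transpose U ** X = 0" "A ** X + U ** S = mat 1"
  shows "invertible (transpose U ** (A - A ** X ** A) ** U) \<longleftrightarrow> rank U = CARD('m)"
    (is "invertible ?K \<longleftrightarrow> _")
proof -
  note X_sym = constrained_inverse_sym[OF sym X]
  have "transpose (mat 1 - X ** A) = mat 1 - A ** X"
    by (simp add: transpose_diff matrix_transpose_mul sym X_sym(1))
  moreover have "A ** X ** (A ** X ** A) = A ** X ** A"
    by (metis X_sym(2) matrix_mul_assoc)
  \<comment> \<open>Since \<open>X ** A ** X = X\<close>, the matrix \<open>mat 1 - X ** A\<close>
    is a projection, orthogonal for the inner product of \<open>A\<close>. Hence \<open>?K\<close>
    is the Gram matrix of the projected columns of \<open>U\<close>.\<close>
  ultimately have fac: "A - A ** X ** A = transpose (mat 1 - X ** A) ** (A ** (mat 1 - X ** A))"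
    by (simp add: matrix_diff_ldistrib matrix_diff_rdistrib matrix_mul_assoc)
  have "?K *v v = 0 \<longleftrightarrow> U *v v = 0" for v
  proof
    assume "?K *v v = 0"
    define z where "z = (mat 1 - X ** A) *v (U *v v)"
    have "z \<bullet> (A *v z) = (U *v v) \<bullet> ((A - A ** X ** A) *v (U *v v))"
      unfolding fac z_def
      by (simp only: matrix_vector_mul_assoc[symmetric] inner_matrix_mult transpose_transpose)
    also have "\<dots> = v \<bullet> (?K *v v)"
      by (simp only: matrix_vector_mul_assoc[symmetric] inner_matrix_mult transpose_transpose)
    also have "\<dots> = 0" by (simp only: \<open>?K *v v = 0\<close>) simp
    finally have "z = 0" using pos[of z] by force
    then have "U *v v = X *v (A *v (U *v v))"
      by (simp only: z_def matrix_vector_mult_diff_rdistrib matrix_vector_mul_lid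
          matrix_vector_mul_assoc[symmetric] right_minus_eq)
    \<comment> \<open>\<open>U *v v\<close> lies in the range of \<open>X\<close>, which is
      orthogonal to the range of \<open>U\<close>, so it is orthogonal to itself.\<close>
    then have "transpose U *v (U *v v) = (transpose U ** X) *v (A *v (U *v v))"
      by (metis matrix_vector_mul_assoc)
    then have "transpose U *v (U *v v) = 0" by (simp only: X(1)) simp
    then have "(U *v v) \<bullet> (U *v v) = 0" by (simp only: inner_matrix_mult) simp
    then show "U *v v = 0" by simp
  next
    assume "U *v v = 0"
    then show "?K *v v = 0"
      by (simp only: matrix_vector_mul_assoc[symmetric]) (simp del: transpose_matrix_vector)
  qed
  then show ?thesis
    by (simp add: invertible_left_inverse matrix_left_invertible_ker full_rank_injective
        vec.inj_iff_eq_0)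
qed

text \<open>Multiplied by \<open>A\<close>, the correction term must supply the
  \<open>U ** S\<close> that \<open>A ** X\<close> lacks. Both outer brackets reduce to expressions
  in \<open>U ** S\<close>, and the factor left between \<open>U\<close> and \<open>S\<close> is the
  identity.\<close>

lemma bus_split_formula:
  fixes A X :: "real^'n^'n" and U :: "real^'m^'n"
  assumes X: "A ** X + U ** S = mat 1"
    and K: "K = transpose U ** (A - A ** X ** A) ** U" "invertible K"
  shows "matrix_inv A = X + (mat 1 - X ** A) ** U ** matrix_inv K ** transpose U ** (mat 1 - A ** X)"
proof (rule matrix_inv_eqI)
  have US: "mat 1 - A ** X = U ** S" by (simp add: X[symmetric])
  have USA: "A ** (mat 1 - X ** A) = U ** S ** A"
    unfolding US[symmetric] by (simp add: matrix_diff_ldistrib matrix_diff_rdistrib matrix_mul_assoc)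
  have "K = transpose U ** (A ** (mat 1 - X ** A)) ** U"
    unfolding K(1) by (simp add: matrix_diff_ldistrib matrix_mul_assoc)
  then have K': "K = (transpose U ** U) ** (S ** A ** U)"
    by (simp add: USA matrix_mul_assoc)
  have "(transpose U ** U) ** (S ** A ** U ** matrix_inv K) = mat 1"
    using matrix_inv_mult(2)[OF K(2)] by (subst (asm) K') (simp add: matrix_mul_assoc)
  \<comment> \<open>For square matrices a right inverse is a left inverse; this moves
    \<open>transpose U ** U\<close> to the other side of the product.\<close>
  then have one: "S ** A ** U ** matrix_inv K ** (transpose U ** U) = mat 1"
    by (rule matrix_left_right_inverse1)
  have "A ** ((mat 1 - X ** A) ** U ** matrix_inv K ** transpose U ** (mat 1 - A ** X))
      = U ** (S ** A ** U ** matrix_inv K ** (transpose U ** U)) ** S"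
    unfolding US by (simp add: matrix_mul_assoc USA)
  also have "\<dots> = U ** S" by (simp only: one) simp
  finally show "A ** (X + (mat 1 - X ** A) ** U ** matrix_inv K ** transpose U ** (mat 1 - A ** X)) = mat 1"
    by (simp add: matrix_add_ldistrib X)
qed

section \<open>Potentials, energy and connectedness of the open grid\<close>

lemma incidence_transpose_mult:
  assumes "grid_with_slack G slack bus"
  obtains f where "\<And>r. f (bus r) = v $ r" "f slack = 0"
    "\<And>e. (transpose (incidence G bus) *v v) $ e = f (tail G e) - f (head G e)"
proof -
  interpret loopfree_digraph G using assms by (simp add: grid_with_slack_def)
  have bij: "bij_betw bus UNIV (UNIV - {slack})" and arcs: "arcs G = UNIV"
    using assms by (auto simp: grid_with_slack_def)
  \<comment> \<open>This extends \<open>v\<close> to a potential on all buses: injectivity of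
    \<open>bus\<close> leaves one summand at each other bus, and at the slack bus none
    survives.\<close>
  define f where "f w = (\<Sum>r\<in>UNIV. if w = bus r then v $ r else 0)" for w
  have "f (bus r) = v $ r" for r
    using bij by (simp add: f_def bij_betw_def inj_eq)
  moreover have "slack \<noteq> bus r" for r using bij by (auto simp: bij_betw_def)
  then have "f slack = 0" by (simp add: f_def)
  moreover have "(transpose (incidence G bus) *v v) $ e = f (tail G e) - f (head G e)" for e
  proof -
    \<comment> \<open>Without loops, the nested conditional in \<open>incidence\<close> is the
      difference of the indicators of tail and head.\<close>
    have "tail G e \<noteq> head G e" using no_loops[of e] arcs by simp
    then show ?thesis
      by (auto simp: transpose_def matrix_vector_mult_def incidence_def f_def
          sum_subtractf[symmetric] simp del: transpose_matrix_vector intro!: sum.cong)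
  qed
  ultimately show ?thesis using that by blast
qed

lemma open_laplacian_sym: "transpose (open_laplacian G bus c b) = open_laplacian G bus c b"
proof -
  have "transpose (open_susceptance c b) = open_susceptance c b"
    by (auto simp: open_susceptance_def transpose_def vec_eq_iff)
  then show ?thesis
    by (simp add: open_laplacian_def matrix_transpose_mul matrix_mul_assoc)
qed

lemma inner_open_laplacian:
  "v \<bullet> (open_laplacian G bus c b *v v)
     = (\<Sum>e\<in>UNIV. (if e \<in> range c then 0 else b e) * ((transpose (incidence G bus) *v v) $ e)\<^sup>2)"
proof -
  have "open_susceptance c b *v w = (\<chi> e. (if e \<in> range c then 0 else b e) * w $ e)" for w
  proof -
    have "(open_susceptance c b *v w) $ e = (\<Sum>f\<in>UNIV. if e = f then (if e \<in> range c then 0 else b e) * w $ f else 0)" for e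
      unfolding open_susceptance_def matrix_vector_mult_def vec_lambda_beta
      by (intro sum.cong refl) auto
    then show ?thesis by (simp add: vec_eq_iff)
  qed
  then have "v \<bullet> (open_laplacian G bus c b *v v) = (transpose (incidence G bus) *v v) \<bullet>
      (\<chi> e. (if e \<in> range c then 0 else b e) * (transpose (incidence G bus) *v v) $ e)"
    by (simp only: open_laplacian_def matrix_vector_mul_assoc[symmetric] inner_matrix_mult)
  then show ?thesis
    by (simp add: inner_vec_def power2_eq_square ac_simps del: transpose_matrix_vector)
qed

text \<open>The form is a weighted sum of squared potential differences. If it vanishes, the
  potential is constant along non-coupler branches, and connectedness spreads the slack value 0 to
  every bus.\<close>

lemma open_laplacian_posdef:
  assumes grid: "grid_with_slack G slack bus"
    and b: "\<And>e. e \<notin> range c \<Longrightarrow> 0 < b e"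
    and conn: "Digraph_Component.connected (open_grid G c)"
    and "v \<noteq> 0"
  shows "0 < v \<bullet> (open_laplacian G bus c b *v v)"
proof (rule ccontr)
  obtain f where f: "\<And>r. f (bus r) = v $ r" "f slack = 0"
    "\<And>e. (transpose (incidence G bus) *v v) $ e = f (tail G e) - f (head G e)"
    using incidence_transpose_mult[OF grid] by blast
  have form: "v \<bullet> (open_laplacian G bus c b *v v)
      = (\<Sum>e\<in>UNIV. (if e \<in> range c then 0 else b e) * (f (tail G e) - f (head G e))\<^sup>2)"
    by (simp add: inner_open_laplacian f(3) del: transpose_matrix_vector)
  have nonneg: "0 \<le> (if e \<in> range c then 0 else b e) * (f (tail G e) - f (head G e))\<^sup>2" for e
    using b[of e] by (auto simp: less_imp_le)
  assume "\<not> 0 < v \<bullet> (open_laplacian G bus c b *v v)"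
  then have "(\<Sum>e\<in>UNIV. (if e \<in> range c then 0 else b e) * (f (tail G e) - f (head G e))\<^sup>2) = 0"
    unfolding form by (intro antisym sum_nonneg nonneg) simp
  then have zero: "\<forall>e. (if e \<in> range c then 0 else b e) * (f (tail G e) - f (head G e))\<^sup>2 = 0"
    by (simp add: sum_nonneg_eq_0_iff[OF finite nonneg])
  have edge: "f (tail G e) = f (head G e)" if "e \<notin> range c" for e
    using zero[rule_format, of e] b[OF that] that by simp
  \<comment> \<open>Paths run in the symmetrised graph; equality of the end potentials holds in
    either direction of a branch.\<close>
  have "f w = 0" for w
  proof -
    have "slack \<rightarrow>\<^sup>*\<^bsub>with_proj (mk_symmetric (open_grid G c))\<^esub> w"
      using conn grid
      by (auto simp: Digraph_Component.connected_def strongly_connected_def open_grid_def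
          grid_with_slack_def)
    from reachable_rtranclI[OF this] show ?thesis
    proof induction
      case base show ?case by (rule f(2))
    next
      case (step x y)
      then have "f x = f y"
        using edge by (auto simp: parcs_mk_symmetric open_grid_def)
      then show ?case using step by simp
    qed
  qed
  then have "v = 0" using f(1) by (simp add: vec_eq_iff)
  with \<open>v \<noteq> 0\<close> show False by simp
qed

text \<open>As \<open>matrix_inv\<close> and \<open>Lim\<close> are total, the formula alone would
  not show that its inverses and limit exist; the other conjuncts settle this. Invertibility of
  \<open>K\<close> is characterised because it can fail: parallel couplers give dependent columns of
  \<open>U\<close>.\<close>

theorem mainTheorem4:
  fixes G :: "('v::finite, 'e::finite) pre_digraph"
    and slack :: 'v
    and bus :: "'r::finite \<Rightarrow> 'v"
    and c :: "'m::finite \<Rightarrow> 'e"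
    and b :: "'e \<Rightarrow> real"
  defines "Bo \<equiv> open_laplacian G bus c b"
    and "Bc_inv \<equiv> closed_inverse G bus c b"
    and "U \<equiv> coupler_matrix G bus c"
  defines "K \<equiv> transpose U ** (Bo - Bo ** Bc_inv ** Bo) ** U"
  assumes grid: "grid_with_slack G slack bus"
    and couplers_distinct: "inj c"
    and susceptance_pos: "\<And>e. e \<notin> range c \<Longrightarrow> 0 < b e"
    and open_connected: "Digraph_Component.connected (open_grid G c)"
  shows "invertible Bo
    \<and> (\<forall>\<beta>. (\<forall>i. 0 \<le> \<beta> i) \<longrightarrow> invertible (coupled_laplacian G bus c b \<beta>))
    \<and> ((\<lambda>\<beta>. matrix_inv (coupled_laplacian G bus c b \<beta>)) \<longlongrightarrow> Bc_inv) all_at_top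
    \<and> (invertible K \<longleftrightarrow> rank U = CARD('m))
    \<and> (invertible K \<longrightarrow>
        matrix_inv Bo = Bc_inv
          + (mat 1 - Bc_inv ** Bo) ** U ** matrix_inv K
            ** transpose U ** (mat 1 - Bo ** Bc_inv))"
proof -
  have pos: "0 < x \<bullet> (Bo *v x)" if "x \<noteq> 0" for x
    unfolding Bo_def using open_laplacian_posdef[OF grid susceptance_pos open_connected that] .
  have sym: "transpose Bo = Bo" unfolding Bo_def by (rule open_laplacian_sym)
  have coupled: "coupled_laplacian G bus c b = (\<lambda>\<beta>. Bo + (\<Sum>i\<in>UNIV. \<beta> i *\<^sub>R outer (column i U)))"
    by (simp add: coupled_laplacian_def Bo_def U_def coupler_matrix_def column_def fun_eq_iff)
  obtain X S where X: "transpose U ** X = 0" "Bo ** X + U ** S = mat 1"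
    using constrained_inverse_exists[OF pos] by blast
  have lim: "((\<lambda>\<beta>. matrix_inv (coupled_laplacian G bus c b \<beta>)) \<longlongrightarrow> X) all_at_top"
    unfolding coupled by (rule coupled_inverse_tendsto[OF pos X])
  \<comment> \<open>The filter is proper, so limits are unique and \<open>Lim\<close> returns the
    constructed \<open>X\<close>.\<close>
  then have XB: "X = Bc_inv"
    unfolding Bc_inv_def closed_inverse_def by (rule tendsto_Lim[OF all_at_top_neq_bot, symmetric])
  note X = X[unfolded XB] and lim = lim[unfolded XB]
  show ?thesis
  proof (intro conjI allI impI)
    show "invertible Bo" by (rule invertible_if_posdef[OF pos])
    show "invertible (coupled_laplacian G bus c b \<beta>)" if "\<forall>i. 0 \<le> \<beta> i" for \<beta>
      unfolding coupled using that by (intro invertible_coupled pos) auto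
    show "invertible K \<longleftrightarrow> rank U = CARD('m)"
      unfolding K_def by (rule invertible_coupler_matrix_iff[OF pos sym X])
    show "matrix_inv Bo = Bc_inv + (mat 1 - Bc_inv ** Bo) ** U ** matrix_inv K
        ** transpose U ** (mat 1 - Bo ** Bc_inv)" if "invertible K"
      by (rule bus_split_formula[OF X(2) K_def[THEN meta_eq_to_obj_eq] that])
  qed (rule lim)
qed

end
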